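(* Let $\epsilon>0$, and let $\{z_t\},\{y_t\},\{x_t\}$ be generated by the AC-FGM algorithm (see context) applied to $\min_{x\in X}\{\Psi(x)=f(x)+h(x)\}$, where $f$ is convex with Hölder continuous (sub)gradients with exponent $\nu\in[0,1]$, with initial point $x_0=y_0=z_0\in X$ and parameters $\eta_t>0$, $\tau_t\ge0$, $\beta_t$. Assume that $x_1\ne x_0$ and that for some $\beta\in(0,1)$ $$\tau_1=0,\qquad\beta_1=0,\qquad\beta_t=\beta\ \ (t\ge2),$$ $$\eta_2\le\min\Big\{(1-\beta)\eta_1,\ \tfrac{1}{4\tilde L_1(\epsilon)}\Big\},$$ $$\eta_t\le\min\Big\{2(1-\beta)^2\eta_{t-1},\ \tfrac{\tau_{t-1}}{4\tilde L_{t-1}(\epsilon)},\ \tfrac{\tau_{t-2}+1}{\tau_{t-1}}\,\eta_{t-1}\Big\}\quad\text{for all }t\ge3,$$ where the $\tilde L_t(\epsilon)$ are defined in the context. Then for every $x^*\in X^*$ and every $k\ge1$, $$\Psi(\bar x_k)-\Psi(x^* )\le\frac{1}{\sum_{t=2}^{k+1}\eta_t}\Big[\tfrac1{2\beta}\|z_0-x^*\|^2+\Big(\tfrac{5\eta_2\tilde L_1(\epsilon)}{4}-\tfrac{\eta_2}{2\eta_1}\Big)\|z_1-z_0\|^2\Big]+\frac\epsilon2,$$ where $$\bar x_k:=\frac{\sum_{t=1}^{k-1}\big[(\tau_t+1)\eta_{t+1}-\tau_{t+1}\eta_{t+2}\big]x_t+(\tau_k+1)\eta_{k+1}x_k}{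\sum_{t=2}^{k+1}\eta_t}.$$
   Context: Problem: $X\subseteq\mathbb{R}^n$ is a nonempty closed convex set, $h:X\to\mathbb{R}$ is a closed convex function, $f:\mathbb{R}^n\to\mathbb{R}$ is convex, $\Psi:=f+h$, and the set $X^*$ of minimizers of $\Psi$ over $X$ is nonempty. $\langle\cdot,\cdot\rangle$ is the Euclidean inner product and $\|\cdot\|$ the Euclidean norm. $g(x)\in\partial f(x)$ denotes the (sub)gradient returned by the first-order oracle at $x$. Hölder condition: for some $\nu\in[0,1]$ and $L_\nu>0$ (unknown to the algorithm), $\|g(x)-g(y)\|\le L_\nu\|x-y\|^\nu$ for all $x,y\in\mathbb{R}^n$. AC-FGM algorithm: starting from $z_0=y_0=x_0\in X$, for $t=1,2,\dots$ $$z_t=\arg\min_{z\in X}\big\{\eta_t[\langle g(x_{t-1}),z\rangle+h(z)]+\tfrac12\|y_{t-1}-z\|^2\big\},$$ $$y_t=(1-\beta_t)y_{t-1}+\beta_tz_t,\qquad x_t=\frac{z_t+\tau_tx_{t-1}}{1+\tau_t}.$$ The parameters may depend on previously generated iterates. Local constants for accuracy $\epsilon>0$: $$\tilde L_1(\epsilon):=\frac{\sqrt{\|x_1-x_0\|^2\|g(x_1)-g(x_0)\|^2+(\epsilon/4)^2}-\epsilon/4}{\|x_1-x_0\|^2},$$ $$\tilde L_t(\epsilon):=\frac{\|g(x_t)-g(x_{t-1})\|^2}{2[f(x_{t-1})-f(x_t)-\langle g(x_t),x_{t-1}-x_t\rangle]+\epsilon/\tau_t}\quad(t\ge2).$$ Conventions: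 $\tfrac00=0$ and $\tfrac a0=+\infty$ for $a>0$. *)

theory Defs
  imports "HOL-Analysis.Analysis"
begin

definition subdifferential :: "('a::euclidean_space \<Rightarrow> real) \<Rightarrow> 'a \<Rightarrow> 'a set" where
  "subdifferential f x = {v. \<forall>y. f y \<ge> f x + v \<bullet> (y - x)}"

definition minimizers :: "'a set \<Rightarrow> ('a \<Rightarrow> real) \<Rightarrow> 'a set" where
  "minimizers X F = {x. is_arg_min F (\<lambda>u. u \<in> X) x}"

text \<open>
  A function \<open>h : X \<rightarrow> \<real>\<close> is represented by a total function whose values outside \<open>X\<close> are
  irrelevant; closedness means closedness of its epigraph over \<open>X\<close>.
\<close>

definition closed_convex_fun_on :: "'a::euclidean_space set \<Rightarrow> ('a \<Rightarrow> real) \<Rightarrow> bool" where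
  "closed_convex_fun_on X h \<longleftrightarrow> convex_on X h \<and> closed (epigraph X h)"

text \<open>
  The powr operation has \<open>0 powr 0 = 0\<close>. This is harmless: for \<open>x = y\<close> the left-hand side
  vanishes, so \<open>\<nu> = 0\<close> gives exactly the bounded-variation condition.
\<close>

definition hoelder_cond :: "real \<Rightarrow> real \<Rightarrow> ('a::euclidean_space \<Rightarrow> 'a) \<Rightarrow> bool" where
  "hoelder_cond \<nu> L g \<longleftrightarrow> (\<forall>x y. norm (g x - g y) \<le> L * norm (x - y) powr \<nu>)"

text \<open>
  The parameters \<open>\<eta>\<close>, \<open>\<tau>\<close>, \<open>\<beta>\<close> are arbitrary sequences, so they may depend on the iterates.
  The objective of the prox-step is strongly convex, so its minimizer is unique.
\<close>

definition AC_FGM ::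
  "'a::euclidean_space set \<Rightarrow> ('a \<Rightarrow> real) \<Rightarrow> ('a \<Rightarrow> 'a) \<Rightarrow>
   (nat \<Rightarrow> real) \<Rightarrow> (nat \<Rightarrow> real) \<Rightarrow> (nat \<Rightarrow> real) \<Rightarrow>
   (nat \<Rightarrow> 'a) \<Rightarrow> (nat \<Rightarrow> 'a) \<Rightarrow> (nat \<Rightarrow> 'a) \<Rightarrow> bool" where
  "AC_FGM X h g \<eta> \<tau> \<beta> z y x \<longleftrightarrow>
     x 0 \<in> X \<and> y 0 = x 0 \<and> z 0 = x 0 \<and>
     (\<forall>t\<ge>1.
        is_arg_min (\<lambda>u. \<eta> t * (g (x (t - 1)) \<bullet> u + h u) + 1/2 * (norm (y (t - 1) - u))\<^sup>2)
          (\<lambda>u. u \<in> X) (z t) \<and>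
        y t = (1 - \<beta> t) *\<^sub>R y (t - 1) + \<beta> t *\<^sub>R z t \<and>
        x t = (z t + \<tau> t *\<^sub>R x (t - 1)) /\<^sub>R (1 + \<tau> t))"

definition Ltilde1 :: "('a::euclidean_space \<Rightarrow> 'a) \<Rightarrow> (nat \<Rightarrow> 'a) \<Rightarrow> real \<Rightarrow> real" where
  "Ltilde1 g x \<epsilon> =
     (sqrt ((norm (x 1 - x 0))\<^sup>2 * (norm (g (x 1) - g (x 0)))\<^sup>2 + (\<epsilon> / 4)\<^sup>2) - \<epsilon> / 4)
       / (norm (x 1 - x 0))\<^sup>2"

text \<open>
  Division on \<^typ>\<open>ereal\<close> satisfies \<open>0 / 0 = 0\<close>, \<open>a / 0 = \<infinity>\<close> for \<open>a > 0\<close>, and \<open>a / \<infinity> = 0\<close>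
  for finite \<open>a\<close>, as intended for vanishing denominators
  (division on \<^typ>\<open>real\<close> would give \<open>a / 0 = 0\<close> instead).
\<close>

definition Ltilde ::
  "('a::euclidean_space \<Rightarrow> real) \<Rightarrow> ('a \<Rightarrow> 'a) \<Rightarrow> (nat \<Rightarrow> real) \<Rightarrow> (nat \<Rightarrow> 'a) \<Rightarrow>
   real \<Rightarrow> nat \<Rightarrow> ereal" where
  "Ltilde f g \<tau> x \<epsilon> t =
     ereal ((norm (g (x t) - g (x (t - 1))))\<^sup>2) /
       (ereal (2 * (f (x (t - 1)) - f (x t) - g (x t) \<bullet> (x (t - 1) - x t)))
          + ereal \<epsilon> / ereal (\<tau> t))"

definition xbar :: "(nat \<Rightarrow> real) \<Rightarrow> (nat \<Rightarrow> real) \<Rightarrow> (nat \<Rightarrow> 'a::euclidean_space) \<Rightarrow> nat \<Rightarrow> 'a" where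
  "xbar \<eta> \<tau> x k =
     ((\<Sum>t=1..k-1. ((\<tau> t + 1) * \<eta> (t + 1) - \<tau> (t + 1) * \<eta> (t + 2)) *\<^sub>R x t)
        + ((\<tau> k + 1) * \<eta> (k + 1)) *\<^sub>R x k) /\<^sub>R (\<Sum>t=2..k+1. \<eta> t)"

end

theory Submission
  imports Defs
begin

text \<open>
  Adding the optimality conditions of two consecutive prox-steps, the older one tested at the newer
  point, bounds the gap at \<open>x (t - 1)\<close> by a telescoping term in \<open>norm (y t - u)\<close>, negative squared
  distances between consecutive points, and the error \<open>(g1 - g0) \<bullet> (z t - z (t - 1))\<close>. By Young's
  inequality this error is paid for partly by the Bregman gap of \<open>f\<close>, through the bound of \<open>\<eta> t\<close> by
  \<open>Ltilde\<close>, and partly by the negative squares; part of the latter is carried to the next iteration,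
  so the potential is \<open>norm (y t - u)^2 / (2 * \<beta>) + (1 - \<beta>)^2 / 4 * norm (z t - y (t - 1))^2\<close>.
  Telescoping and Jensen's inequality give the rate.
\<close>

section \<open>Variational inequalities for the prox-step\<close>

text \<open>Comparing \<open>z\<close> with points on the segment from \<open>z\<close> to
  \<open>u\<close> and dividing by the step \<open>s\<close> leaves an error linear in
  \<open>s\<close>, which vanishes as \<open>s\<close> tends to 0. The result contains values of
  \<open>h\<close>, which convexity supplies along the segment, in place of a subgradient.\<close>

lemma prox_optimality:
  fixes h :: "'a::euclidean_space \<Rightarrow> real"
  assumes h: "convex_on X h" and X: "convex X"
    and min: "is_arg_min (\<lambda>u. \<eta> * (v \<bullet> u + h u) + 1/2 * (norm (y - u))\<^sup>2) (\<lambda>u. u \<in> X) z"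
    and \<eta>: "\<eta> > 0" and u: "u \<in> X"
  shows "0 \<le> \<eta> * (v \<bullet> (u - z) + h u - h z) + (z - y) \<bullet> (u - z)" (is "0 \<le> ?Q")
proof -
  have z: "z \<in> X" using min by (auto simp: is_arg_min_def)
  have step: "0 \<le> ?Q + s / 2 * (norm (u - z))\<^sup>2" if s: "0 < s" "s \<le> 1" for s
  proof -
    define w where "w = (1 - s) *\<^sub>R z + s *\<^sub>R u"
    have w: "w \<in> X" unfolding w_def using X z u s by (intro convexD) auto
    have hw: "h w \<le> (1 - s) * h z + s * h u"
      unfolding w_def using convex_onD[OF h _ _ z u] s by simp
    have le: "\<eta> * (v \<bullet> z + h z) + 1/2 * (norm (y - z))\<^sup>2
        \<le> \<eta> * (v \<bullet> w + h w) + 1/2 * (norm (y - w))\<^sup>2"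
      using min w by (auto simp: is_arg_min_linorder)
    have wz: "w = z + s *\<^sub>R (u - z)" by (simp add: w_def algebra_simps)
    have "(norm (y - w))\<^sup>2
        = (norm (y - z))\<^sup>2 + 2 * s * ((z - y) \<bullet> (u - z)) + s\<^sup>2 * (norm (u - z))\<^sup>2"
      unfolding wz power2_norm_eq_inner
      by (simp add: inner_simps inner_commute algebra_simps power2_eq_square)
    moreover have "\<eta> * (v \<bullet> w) = \<eta> * (v \<bullet> z) + s * (\<eta> * (v \<bullet> (u - z)))"
      by (simp add: wz inner_simps algebra_simps)
    moreover have "\<eta> * h w \<le> \<eta> * ((1 - s) * h z + s * h u)"
      using hw \<eta> by (simp add: mult_left_mono)
    ultimately have "0 \<le> s * (?Q + s / 2 * (norm (u - z))\<^sup>2)"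
      using le by (simp add: algebra_simps power2_eq_square)
    then show ?thesis using s by (simp add: zero_le_mult_iff)
  qed
  have "((\<lambda>s. ?Q + s / 2 * (norm (u - z))\<^sup>2) \<longlongrightarrow> ?Q + 0 / 2 * (norm (u - z))\<^sup>2) (at_right 0)"
    by (intro tendsto_intros) auto
  moreover have "\<forall>\<^sub>F s in at_right 0. 0 \<le> ?Q + s / 2 * (norm (u - z))\<^sup>2"
    using eventually_at_right_real[of 0 "1::real"] by (rule eventually_mono) (use step in auto)
  ultimately have "0 \<le> ?Q + 0 / 2 * (norm (u - z))\<^sup>2"
    by (intro tendsto_lowerbound) auto
  then show ?thesis by simp
qed

text \<open>
  The previous prox-step, tested at the new point \<open>z\<close>, trades \<open>g0\<close> for \<open>g1\<close> and \<open>h z\<close> for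
  \<open>h zp\<close>, so that all first-order information ends up at the old point \<open>zp\<close>.
\<close>

lemma prox_pair_bound:
  fixes z zp y0 y1 yp g0 g1 u :: "'a::real_inner"
  assumes opt: "0 \<le> \<eta> * (g1 \<bullet> (u - z) + hu - hz) + (z - y0) \<bullet> (u - z)"
    and prev: "0 \<le> \<eta>p * (g0 \<bullet> (z - zp) + hz - hp) + (zp - yp) \<bullet> (z - zp)"
    and link: "zp - y0 = (1 - b) *\<^sub>R (zp - yp)" and b: "b < 1"
    and y1: "y1 = (1 - \<beta>) *\<^sub>R y0 + \<beta> *\<^sub>R z" and \<beta>: "\<beta> > 0"
    and \<eta>: "\<eta> > 0" "\<eta>p > 0" and r: "r = \<eta> / (\<eta>p * (1 - b))"
  shows "\<eta> * (g1 \<bullet> (zp - u) + hp - hu)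
    \<le> 1 / (2 * \<beta>) * (norm (y0 - u))\<^sup>2 - 1 / (2 * \<beta>) * (norm (y1 - u))\<^sup>2
      - (2 - \<beta> - r) / 2 * (norm (z - y0))\<^sup>2 - r / 2 * (norm (zp - y0))\<^sup>2
      - r / 2 * (norm (z - zp))\<^sup>2 - \<eta> * ((g1 - g0) \<bullet> (z - zp))"
proof -
  \<comment> \<open>The factor \<open>\<eta> / \<eta>p\<close> gives the older condition the weight
    of the newer one. Replacing \<open>zp - yp\<close> by \<open>zp - y0\<close> through
    \<open>link\<close> then costs the factor \<open>1 / (1 - b)\<close> in
    \<open>r\<close>.\<close>
  have "0 \<le> \<eta> / \<eta>p * (\<eta>p * (g0 \<bullet> (z - zp) + hz - hp) + (zp - yp) \<bullet> (z - zp))"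
    using prev \<eta> by (intro mult_nonneg_nonneg) auto
  also have "\<dots> = \<eta> * (g0 \<bullet> (z - zp) + hz - hp) + r * ((zp - y0) \<bullet> (z - zp))"
  proof -
    have "r * ((zp - y0) \<bullet> (z - zp)) = \<eta> / \<eta>p * ((zp - yp) \<bullet> (z - zp))"
      unfolding link r inner_scaleR_left using b by simp
    then show ?thesis using \<eta> by (simp add: distrib_left)
  qed
  finally have p: "0 \<le> \<eta> * (g0 \<bullet> (z - zp) + hz - hp) + r * ((zp - y0) \<bullet> (z - zp))" .
  have i1: "(zp - y0) \<bullet> (z - zp)
      = ((norm (z - y0))\<^sup>2 - (norm (zp - y0))\<^sup>2 - (norm (z - zp))\<^sup>2) / 2"
    by (simp add: power2_norm_eq_inner inner_simps inner_commute)
  \<comment> \<open>Since \<open>y1 - u = (y0 - u) + \<beta> *\<^sub>R (z - y0)\<close>, division by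
    \<open>2 * \<beta>\<close> leaves the mixed product with coefficient 1, and it cancels the one
    in \<open>i3\<close>. This is the origin of the weight \<open>1 / (2 * \<beta>)\<close>.\<close>
  have "(norm (y1 - u))\<^sup>2 = (norm (y0 - u))\<^sup>2 + 2 * \<beta> * ((y0 - u) \<bullet> (z - y0))
      + \<beta>\<^sup>2 * (norm (z - y0))\<^sup>2"
    unfolding y1 power2_norm_eq_inner
    by (simp add: inner_simps inner_commute algebra_simps power2_eq_square)
  then have i2: "1 / (2 * \<beta>) * (norm (y1 - u))\<^sup>2
      = 1 / (2 * \<beta>) * (norm (y0 - u))\<^sup>2 + (y0 - u) \<bullet> (z - y0) + \<beta> / 2 * (norm (z - y0))\<^sup>2"
    using \<beta> by (simp add: field_simps power2_eq_square)
  have i3: "(z - y0) \<bullet> (u - z) = - ((y0 - u) \<bullet> (z - y0)) - (norm (z - y0))\<^sup>2"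
    by (simp add: power2_norm_eq_inner inner_simps inner_commute)
  have i4: "g1 \<bullet> (zp - u) + hp - hu
      = - (g1 \<bullet> (u - z) + hu - hz) - (g0 \<bullet> (z - zp) + hz - hp) - (g1 - g0) \<bullet> (z - zp)"
    by (simp add: inner_simps)
  have "\<eta> * (g1 \<bullet> (zp - u) + hp - hu)
      = - (\<eta> * (g1 \<bullet> (u - z) + hu - hz)) - \<eta> * (g0 \<bullet> (z - zp) + hz - hp)
        - \<eta> * ((g1 - g0) \<bullet> (z - zp))"
    unfolding i4 by (simp add: algebra_simps)
  also have "\<dots> \<le> (z - y0) \<bullet> (u - z) + r * ((zp - y0) \<bullet> (z - zp)) - \<eta> * ((g1 - g0) \<bullet> (z - zp))"
    using opt p by linarith
  finally show ?thesis
    unfolding i2 i3 i1 by (simp add: field_simps)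
qed

section \<open>Elementary quadratic inequalities\<close>

lemma norm_diff_sq_le:
  fixes a b c :: "'a::real_inner"
  shows "(norm (a - c))\<^sup>2 \<le> 2 * (norm (a - b))\<^sup>2 + 2 * (norm (b - c))\<^sup>2"
proof -
  have "0 \<le> (norm ((a - b) - (b - c)))\<^sup>2" by simp
  then show ?thesis
    by (simp add: power2_norm_eq_inner inner_simps inner_commute)
qed

text \<open>The weight \<open>c\<close> stays free because the general iteration takes 2 and the
  first one takes 1.\<close>

lemma inner_young:
  fixes a b :: "'a::real_inner"
  assumes c: "c > 0"
  shows "- (\<eta> * (a \<bullet> b)) \<le> c * \<eta>\<^sup>2 * (norm a)\<^sup>2 + 1 / (4 * c) * (norm b)\<^sup>2"
proof -
  have "0 \<le> (norm ((2 * c * \<eta>) *\<^sub>R a + b))\<^sup>2 / (4 * c)" using c by simp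
  also have "\<dots> = c * \<eta>\<^sup>2 * (norm a)\<^sup>2 + 1 / (4 * c) * (norm b)\<^sup>2 + \<eta> * (a \<bullet> b)"
    unfolding power2_norm_eq_inner using c
    by (simp add: inner_simps inner_commute field_simps power2_eq_square)
  finally show ?thesis by simp
qed

text \<open>\<open>A\<close>, \<open>B\<close>, \<open>C\<close> stand for the squared sides of the
  triangle with vertices \<open>z t\<close>, \<open>z (t - 1)\<close>, \<open>y (t - 1)\<close>, and
  \<open>AC\<close> is the parallelogram bound for it. On the left are the part of the potential
  handed on and the Young cost \<open>C / 8\<close>; on the right, the available negative squares
  plus the inherited \<open>B / 4\<close>.\<close>

lemma potential_coefficients:
  fixes A B C r \<beta> :: real
  assumes \<beta>: "0 < \<beta>" "\<beta> < 1" and r: "0 \<le> r" "r \<le> 2 * (1 - \<beta>)"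
    and nonneg: "0 \<le> A" "0 \<le> B" "0 \<le> C"
    and AC: "A \<le> 2 * B + 2 * C" "C \<le> 2 * A + 2 * B"
  shows "(1 - \<beta>)\<^sup>2 / 4 * A + C / 8
    \<le> (2 - \<beta> - r) / 2 * A + (r / 2 + 1 / 4) * B + r / 2 * C"
proof -
  \<comment> \<open>\<open>p\<close> is the coefficient of \<open>A\<close> in right side minus left
    side. For small \<open>r\<close> only \<open>C\<close> can have a negative coefficient, and
    \<open>A\<close> and \<open>B\<close> pay for it; if \<open>p\<close> is negative, then
    \<open>r\<close> is at least 1, and \<open>B\<close> and \<open>C\<close> pay for
    \<open>A\<close>.\<close>
  define p where "p = 3/4 - \<beta>\<^sup>2 / 4 - r / 2"
  have \<beta>2: "0 \<le> \<beta>\<^sup>2" "\<beta>\<^sup>2 \<le> \<beta>" using \<beta> by (auto simp: power2_eq_square mult_le_one)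
  have "0 \<le> p * A + (r / 2 + 1 / 4) * B + (r / 2 - 1 / 8) * C"
  proof (cases "p \<ge> 0")
    case True
    show ?thesis
    proof (cases "r \<ge> 1/4")
      case True
      then show ?thesis using \<open>p \<ge> 0\<close> nonneg by (intro add_nonneg_nonneg mult_nonneg_nonneg) auto
    next
      case False
      have "C / 8 \<le> A / 4 + B / 4" using AC by linarith
      moreover have "A / 4 \<le> p * A"
        using mult_right_mono[of "1/4" p A] False \<beta> \<beta>2 nonneg by (simp add: p_def)
      moreover have "0 \<le> r / 2 * B" "0 \<le> r / 2 * C" using r nonneg by auto
      ultimately show ?thesis unfolding distrib_right left_diff_distrib by linarith
    qed
  next
    case False
    have p: "- p \<le> 1/4" "- p \<le> r / 2 - 1/2" "r \<ge> 1"
      using False r \<beta> \<beta>2 by (auto simp: p_def)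
    have "(- p) * A \<le> (- p) * (2 * B + 2 * C)"
      using False AC by (intro mult_left_mono) auto
    also have "\<dots> = (- 2 * p) * B + (- 2 * p) * C" by (simp add: algebra_simps)
    also have "\<dots> \<le> (r / 2 + 1 / 4) * B + (r / 2 - 1 / 8) * C"
      using p nonneg by (intro add_mono mult_right_mono) auto
    finally show ?thesis by simp
  qed
  then show ?thesis by (simp add: p_def power2_eq_square field_simps)
qed

section \<open>The local constants as real inequalities\<close>

lemma le_divide_LtildeD:
  assumes le: "ereal \<eta> \<le> ereal (\<tau> t) / (4 * Ltilde f g \<tau> x \<epsilon> t)"
    and \<eta>: "\<eta> > 0" and \<tau>: "\<tau> t \<ge> 0" and \<epsilon>: "\<epsilon> > 0"
    and sub: "g (x t) \<in> subdifferential f (x t)"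
  shows "\<tau> t > 0"
    and "4 * \<eta> * (norm (g (x t) - g (x (t - 1))))\<^sup>2
      \<le> 2 * \<tau> t * (f (x (t - 1)) - f (x t) - g (x t) \<bullet> (x (t - 1) - x t)) + \<epsilon>"
proof -
  define G where "G = (norm (g (x t) - g (x (t - 1))))\<^sup>2"
  define D where "D = f (x (t - 1)) - f (x t) - g (x t) \<bullet> (x (t - 1) - x t)"
  have "f (x t) + g (x t) \<bullet> (x (t - 1) - x t) \<le> f (x (t - 1))"
    using sub unfolding subdifferential_def by blast
  then have D: "D \<ge> 0" by (simp add: D_def)
  have G: "G \<ge> 0" by (simp add: G_def)
  show pos: "\<tau> t > 0"
  \<comment> \<open>With \<open>\<tau> t = 0\<close> the extended-real bound would read
    \<open>\<eta> \<le> 0\<close>. Hence \<open>\<epsilon> / \<tau> t\<close> is finite and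
    positive, and the denominator of \<open>Ltilde\<close> cannot vanish.\<close>
  proof (rule ccontr)
    assume "\<not> \<tau> t > 0"
    then have "\<tau> t = 0" using \<tau> by simp
    then show False using le \<eta> by (simp add: zero_ereal_def[symmetric])
  qed
  define K where "K = 2 * D + \<epsilon> / \<tau> t"
  have K: "K > 0" using D pos \<epsilon> by (simp add: K_def add_nonneg_pos)
  have L: "Ltilde f g \<tau> x \<epsilon> t = ereal (G / K)"
    using pos K by (simp add: Ltilde_def G_def D_def K_def)
  have "4 * \<eta> * G \<le> \<tau> t * K"
  \<comment> \<open>For \<open>G = 0\<close> the constant is 0 and the bound on
    \<open>\<eta>\<close> is infinite, hence void, but the claim has 0 on its left.\<close>
  proof (cases "G = 0")
    case True
    then show ?thesis using pos K by simp
  next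
    case False
    then have "\<eta> \<le> \<tau> t / (4 * (G / K))" using le L K by simp
    then show ?thesis using False G K by (simp add: field_simps)
  qed
  also have "\<tau> t * K = 2 * \<tau> t * D + \<epsilon>" using pos by (simp add: K_def field_simps)
  finally show "4 * \<eta> * (norm (g (x t) - g (x (t - 1))))\<^sup>2
      \<le> 2 * \<tau> t * (f (x (t - 1)) - f (x t) - g (x t) \<bullet> (x (t - 1) - x t)) + \<epsilon>"
    by (simp add: G_def D_def)
qed

text \<open>\<open>Ltilde1\<close> is the larger root \<open>l\<close> of
  \<open>N * l^2 + l * \<epsilon> / 2 = G\<close>: completing the square gives
  \<open>N * l + \<epsilon> / 4 = S\<close>. The last bound is Cauchy-Schwarz, since
  \<open>S\<close> is at least the square root of \<open>N * G\<close>.\<close>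

lemma Ltilde1_properties:
  fixes g :: "'a::euclidean_space \<Rightarrow> 'a"
  defines "N \<equiv> \<lambda>x::nat \<Rightarrow> 'a. (norm (x 1 - x 0))\<^sup>2"
    and "G \<equiv> \<lambda>x::nat \<Rightarrow> 'a. (norm (g (x 1) - g (x 0)))\<^sup>2"
  assumes ne: "x 1 \<noteq> x 0" and \<epsilon>: "\<epsilon> > 0"
  shows "0 \<le> Ltilde1 g x \<epsilon>"
    and "G x = (Ltilde1 g x \<epsilon>)\<^sup>2 * N x + Ltilde1 g x \<epsilon> * \<epsilon> / 2"
    and "(g (x 1) - g (x 0)) \<bullet> (x 1 - x 0) \<le> Ltilde1 g x \<epsilon> * N x + \<epsilon> / 4"
proof -
  define S where "S = sqrt (N x * G x + (\<epsilon> / 4)\<^sup>2)"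
  have N: "N x > 0" using ne by (simp add: N_def)
  have L: "Ltilde1 g x \<epsilon> = (S - \<epsilon> / 4) / N x" by (simp add: Ltilde1_def S_def N_def G_def)
  have S: "\<epsilon> / 4 \<le> S"
    unfolding S_def using \<epsilon> N by (intro real_le_rsqrt) (auto simp: G_def)
  then show pos: "0 \<le> Ltilde1 g x \<epsilon>" using N by (simp add: L)
  have SL: "S = Ltilde1 g x \<epsilon> * N x + \<epsilon> / 4" using N by (simp add: L)
  have S2: "S\<^sup>2 = N x * G x + (\<epsilon> / 4)\<^sup>2" unfolding S_def by (simp add: N_def G_def)
  then have "N x * G x = N x * ((Ltilde1 g x \<epsilon>)\<^sup>2 * N x + Ltilde1 g x \<epsilon> * \<epsilon> / 2)"
    unfolding SL by (simp add: power2_eq_square algebra_simps)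
  then show "G x = (Ltilde1 g x \<epsilon>)\<^sup>2 * N x + Ltilde1 g x \<epsilon> * \<epsilon> / 2"
    using N by simp
  have "(g (x 1) - g (x 0)) \<bullet> (x 1 - x 0) \<le> norm (g (x 1) - g (x 0)) * norm (x 1 - x 0)"
    by (rule norm_cauchy_schwarz)
  also have "\<dots> \<le> S"
    unfolding S_def by (rule real_le_rsqrt) (simp add: N_def G_def power_mult_distrib)
  finally show "(g (x 1) - g (x 0)) \<bullet> (x 1 - x 0) \<le> Ltilde1 g x \<epsilon> * N x + \<epsilon> / 4"
    unfolding SL .
qed

section \<open>Convexity along the extrapolated and averaged iterates\<close>

lemma extrapolation_convex:
  fixes F :: "'a::real_vector \<Rightarrow> real"
  assumes F: "convex_on X F" and \<tau>: "\<tau> \<ge> 0" and zX: "z \<in> X" and wX: "w \<in> X"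
    and x: "x = (z + \<tau> *\<^sub>R w) /\<^sub>R (1 + \<tau>)"
  shows "(1 + \<tau>) * F x \<le> F z + \<tau> * F w" and "x \<in> X"
proof -
  have eq: "x = (1 - \<tau> / (1 + \<tau>)) *\<^sub>R z + (\<tau> / (1 + \<tau>)) *\<^sub>R w"
  proof -
    have "1 - \<tau> / (1 + \<tau>) = inverse (1 + \<tau>)" using \<tau> by (simp add: field_simps)
    then show ?thesis by (simp add: x scaleR_add_right divide_inverse mult.commute)
  qed
  have s: "0 \<le> \<tau> / (1 + \<tau>)" "\<tau> / (1 + \<tau>) \<le> 1" using \<tau> by (auto simp: field_simps)
  have "convex X" using F by (simp add: convex_on_def)
  then show "x \<in> X" unfolding eq using s zX wX by (intro convexD) auto
  have "F x \<le> (1 - \<tau> / (1 + \<tau>)) * F z + \<tau> / (1 + \<tau>) * F w"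
    unfolding eq using convex_onD[OF F s zX wX] .
  then have "(1 + \<tau>) * F x \<le> (1 + \<tau>) * ((1 - \<tau> / (1 + \<tau>)) * F z + \<tau> / (1 + \<tau>) * F w)"
    using \<tau> by (intro mult_left_mono) auto
  also have "\<dots> = F z + \<tau> * F w"
  proof -
    have "(1 + \<tau>) * (1 - \<tau> / (1 + \<tau>)) = 1" "(1 + \<tau>) * (\<tau> / (1 + \<tau>)) = \<tau>"
      using \<tau> by (auto simp: field_simps)
    then show ?thesis unfolding distrib_left mult.assoc[symmetric] by simp
  qed
  finally show "(1 + \<tau>) * F x \<le> F z + \<tau> * F w" .
qed

text \<open>Summation by parts, which produces the weights of \<open>xbar\<close>;
  \<open>\<tau> 1 = 0\<close> removes the value at index 0.\<close>

lemma weighted_sum_by_parts: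
  fixes F :: "nat \<Rightarrow> real"
  assumes k: "k \<ge> 1" and \<tau>1: "\<tau> 1 = 0"
  shows "(\<Sum>t=2..k+1. \<eta> t * ((1 + \<tau> (t - 1)) * F (t - 1) - \<tau> (t - 1) * F (t - 2)))
    = (\<Sum>t=1..k-1. ((\<tau> t + 1) * \<eta> (t + 1) - \<tau> (t + 1) * \<eta> (t + 2)) * F t)
      + (\<tau> k + 1) * \<eta> (k + 1) * F k"
  using k
proof (induction k rule: dec_induct)
  case base
  then show ?case using \<tau>1 by (simp add: numeral_2_eq_2)
next
  case (step k)
  have "{1..k} = insert k {1..k-1}" using step by auto
  moreover have "k \<notin> {1..k-1}" using step by auto
  ultimately have "(\<Sum>t=1..k. ((\<tau> t + 1) * \<eta> (t + 1) - \<tau> (t + 1) * \<eta> (t + 2)) * F t)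
      = (\<Sum>t=1..k-1. ((\<tau> t + 1) * \<eta> (t + 1) - \<tau> (t + 1) * \<eta> (t + 2)) * F t)
        + ((\<tau> k + 1) * \<eta> (k + 1) - \<tau> (k + 1) * \<eta> (k + 2)) * F k"
    by simp
  then show ?case using step by (simp add: algebra_simps)
qed

lemma xbar_convex_le:
  fixes \<Phi> :: "'a::euclidean_space \<Rightarrow> real"
  assumes \<Phi>: "convex_on X \<Phi>" and xX: "\<And>t. x t \<in> X" and k: "k \<ge> 1" and \<tau>1: "\<tau> 1 = 0"
    and \<tau>: "\<And>t. t \<ge> 1 \<Longrightarrow> \<tau> t \<ge> 0" and \<eta>: "\<And>t. t \<ge> 1 \<Longrightarrow> \<eta> t > 0"
    and mono: "\<And>t. t \<ge> 1 \<Longrightarrow> \<tau> (t + 1) * \<eta> (t + 2) \<le> (\<tau> t + 1) * \<eta> (t + 1)"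
  shows "(\<Sum>t=2..k+1. \<eta> t) * (\<Phi> (xbar \<eta> \<tau> x k) - c)
    \<le> (\<Sum>t=2..k+1. \<eta> t * ((1 + \<tau> (t - 1)) * \<Phi> (x (t - 1)) - \<tau> (t - 1) * \<Phi> (x (t - 2)) - c))"
proof -
  define S where "S = (\<Sum>t=2..k+1. \<eta> t)"
  define a where "a = (\<lambda>t. if t = k then (\<tau> k + 1) * \<eta> (k + 1)
    else (\<tau> t + 1) * \<eta> (t + 1) - \<tau> (t + 1) * \<eta> (t + 2))"
  have set: "{1..k} = insert k {1..k-1}" using k by auto
  have S: "S > 0" unfolding S_def using k \<eta> by (intro sum_pos) auto
  \<comment> \<open>The type of \<open>F\<close> is general because the identity serves both for
    real values and for the points \<open>x t\<close>.\<close>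
  have split: "(\<Sum>t=1..k. a t *\<^sub>R F t)
      = (\<Sum>t=1..k-1. ((\<tau> t + 1) * \<eta> (t + 1) - \<tau> (t + 1) * \<eta> (t + 2)) *\<^sub>R F t)
        + ((\<tau> k + 1) * \<eta> (k + 1)) *\<^sub>R F k" for F :: "nat \<Rightarrow> 'b::real_vector"
  proof -
    have "(\<Sum>t=1..k-1. a t *\<^sub>R F t)
        = (\<Sum>t=1..k-1. ((\<tau> t + 1) * \<eta> (t + 1) - \<tau> (t + 1) * \<eta> (t + 2)) *\<^sub>R F t)"
      using k by (intro sum.cong) (auto simp: a_def)
    moreover have "k \<notin> {1..k-1}" using k by auto
    ultimately show ?thesis unfolding set by (simp add: a_def)
  qed
  have parts: "(\<Sum>t=1..k. a t * F t)
      = (\<Sum>t=2..k+1. \<eta> t * ((1 + \<tau> (t - 1)) * F (t - 1) - \<tau> (t - 1) * F (t - 2)))" for F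
    using weighted_sum_by_parts[where F = F and \<eta> = \<eta> and \<tau> = \<tau>, OF k \<tau>1] split[of F] by simp
  \<comment> \<open>For constant \<open>F = 1\<close> each bracket in \<open>parts\<close> equals 1,
    so only the stepsizes remain. Together with \<open>mono\<close>, which gives nonnegative
    weights, this makes \<open>xbar\<close> a convex combination.\<close>
  have asum: "(\<Sum>t=1..k. a t) = S"
    using parts[of "\<lambda>_. 1"] by (simp add: S_def algebra_simps)
  have a: "a t \<ge> 0" if "t \<in> {1..k}" for t
    using that mono[of t] \<tau>[of t] \<eta>[of "t + 1"] by (auto simp: a_def)
  have xb: "xbar \<eta> \<tau> x k = (\<Sum>t=1..k. (a t / S) *\<^sub>R x t)"
  proof -
    have "xbar \<eta> \<tau> x k = (\<Sum>t=1..k. a t *\<^sub>R x t) /\<^sub>R S"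
      unfolding xbar_def S_def split ..
    then show ?thesis by (simp add: scaleR_sum_right divide_inverse mult.commute)
  qed
  have "\<Phi> (xbar \<eta> \<tau> x k) \<le> (\<Sum>t=1..k. a t / S * \<Phi> (x t))"
    unfolding xb using k S a xX asum
    by (intro convex_on_sum[OF _ _ \<Phi>]) (auto simp: sum_divide_distrib[symmetric])
  also have "\<dots> = (\<Sum>t=1..k. a t * \<Phi> (x t)) / S"
    by (simp add: sum_divide_distrib)
  finally have avg: "S * \<Phi> (xbar \<eta> \<tau> x k) \<le> (\<Sum>t=1..k. a t * \<Phi> (x t))"
    using S by (simp add: field_simps)
  have shift: "(\<Sum>t=2..k+1. \<eta> t * (E t - c)) = (\<Sum>t=2..k+1. \<eta> t * E t) - S * c" for E
    unfolding S_def right_diff_distrib sum_subtractf sum_distrib_right ..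
  show ?thesis
    unfolding S_def[symmetric] right_diff_distrib[of S] shift
    by (rule diff_right_mono[OF avg[unfolded parts]])
qed

section \<open>The convergence rate\<close>

theorem theorem2:
  fixes X :: "(real ^ 'n) set"
    and f h \<Psi> :: "real ^ 'n \<Rightarrow> real"
    and g :: "real ^ 'n \<Rightarrow> real ^ 'n"
    and \<eta> \<tau> \<beta>s :: "nat \<Rightarrow> real"
    and x y z :: "nat \<Rightarrow> real ^ 'n"
    and \<epsilon> \<nu> L \<beta> :: real
  assumes "X \<noteq> {}" and "closed X" and "convex X"
    and "closed_convex_fun_on X h"
    and "convex_on UNIV f"
    and Psi: "\<And>u. \<Psi> u = f u + h u"
    and "minimizers X \<Psi> \<noteq> {}"
    and "\<And>u. g u \<in> subdifferential f u"
    and "0 \<le> \<nu>" and "\<nu> \<le> 1" and "L > 0" and "hoelder_cond \<nu> L g"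
    and "\<epsilon> > 0"
    and "AC_FGM X h g \<eta> \<tau> \<beta>s z y x"
    and "\<And>t. t \<ge> 1 \<Longrightarrow> \<eta> t > 0"
    and "\<And>t. t \<ge> 1 \<Longrightarrow> \<tau> t \<ge> 0"
    and "x 1 \<noteq> x 0"
    and "0 < \<beta>" and "\<beta> < 1"
    and "\<tau> 1 = 0" and "\<beta>s 1 = 0" and "\<And>t. t \<ge> 2 \<Longrightarrow> \<beta>s t = \<beta>"
    and "ereal (\<eta> 2) \<le> min (ereal ((1 - \<beta>) * \<eta> 1)) (1 / (4 * ereal (Ltilde1 g x \<epsilon>)))"
    and "\<And>t. t \<ge> 3 \<Longrightarrow>
           ereal (\<eta> t) \<le> min (ereal (2 * (1 - \<beta>)\<^sup>2 * \<eta> (t - 1)))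
             (min (ereal (\<tau> (t - 1)) / (4 * Ltilde f g \<tau> x \<epsilon> (t - 1)))
               (ereal (\<tau> (t - 2) + 1) / ereal (\<tau> (t - 1)) * ereal (\<eta> (t - 1))))"
  shows "\<forall>xstar \<in> minimizers X \<Psi>. \<forall>k\<ge>1.
           \<Psi> (xbar \<eta> \<tau> x k) - \<Psi> xstar
             \<le> 1 / (\<Sum>t=2..k+1. \<eta> t) *
                 (1 / (2 * \<beta>) * (norm (z 0 - xstar))\<^sup>2
                   + (5 * \<eta> 2 * Ltilde1 g x \<epsilon> / 4 - \<eta> 2 / (2 * \<eta> 1)) * (norm (z 1 - z 0))\<^sup>2)
               + \<epsilon> / 2"
proof (intro ballI allI impI)
  fix u k
  assume "u \<in> minimizers X \<Psi>" and k: "(k::nat) \<ge> 1"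
  then have uX: "u \<in> X" by (simp add: minimizers_def is_arg_min_def)
  note Xconv = assms(3) and sub = assms(8) and \<epsilon> = assms(13) and \<eta> = assms(15) and \<tau> = assms(16)
    and \<beta> = assms(18,19) and \<tau>1 = assms(20) and \<beta>s = assms(21,22) and \<eta>2 = assms(23)
  have hconv: "convex_on X h" using assms(4) by (simp add: closed_convex_fun_on_def)
  have zero: "x 0 \<in> X" "y 0 = x 0" "z 0 = x 0" using assms(14) by (auto simp: AC_FGM_def)
  have min: "is_arg_min (\<lambda>w. \<eta> t * (g (x (t - 1)) \<bullet> w + h w) + 1/2 * (norm (y (t - 1) - w))\<^sup>2)
      (\<lambda>w. w \<in> X) (z t)"
    and ys: "y t = (1 - \<beta>s t) *\<^sub>R y (t - 1) + \<beta>s t *\<^sub>R z t"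
    and xs: "x t = (z t + \<tau> t *\<^sub>R x (t - 1)) /\<^sub>R (1 + \<tau> t)" if "t \<ge> 1" for t
    using assms(14) that by (auto simp: AC_FGM_def)
  have zX: "z t \<in> X" if "t \<ge> 1" for t
    using min[OF that] by (simp add: is_arg_min_def)
  have xX: "x t \<in> X" for t
  proof (induction t)
    case (Suc t)
    show ?case
      using extrapolation_convex(2)[OF hconv \<tau> zX Suc xs[of "Suc t", simplified]] by simp
  qed (use zero in simp)
  have fconv: "convex_on X f" using assms(5) Xconv convex_on_subset by blast
  have \<Psi>conv: "convex_on X \<Psi>"
  proof -
    have "\<Psi> = (\<lambda>u. f u + h u)" using Psi by auto
    then show ?thesis using convex_on_add[OF fconv hconv] by simp
  qed

  \<comment> \<open>\<open>e t\<close> is the summand of \<open>xbar_convex_le\<close>, and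
    \<open>D t\<close> is the Bregman gap that appears in the denominator of
    \<open>Ltilde\<close>.\<close>
  define e where "e = (\<lambda>t. \<eta> t * ((1 + \<tau> (t - 1)) * \<Psi> (x (t - 1)) - \<tau> (t - 1) * \<Psi> (x (t - 2)) - \<Psi> u))"
  define D where "D = (\<lambda>t. f (x (t - 1)) - f (x t) - g (x t) \<bullet> (x (t - 1) - x t))"
  define V where "V = (\<lambda>t. 1 / (2 * \<beta>) * (norm (y t - u))\<^sup>2 + (1 - \<beta>)\<^sup>2 / 4 * (norm (z t - y (t - 1)))\<^sup>2)"

  \<comment> \<open>The extrapolation writes \<open>z (t - 1)\<close> as \<open>x (t - 1)\<close>
    plus \<open>\<tau> (t - 1)\<close> times the last increment. The subgradient inequality handles
    the first piece; the slack of the linearization along the second is exactly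
    \<open>D (t - 1)\<close>, kept to pay for the gradient error.\<close>
  have gap: "e t + \<eta> t * (\<tau> (t - 1) * D (t - 1))
      \<le> \<eta> t * (g (x (t - 1)) \<bullet> (z (t - 1) - u) + h (z (t - 1)) - h u)" if t: "t \<ge> 2" for t
  proof -
    have t1: "t - 1 \<ge> 1" "t - 1 - 1 = t - 2" using t by auto
    have hx: "(1 + \<tau> (t - 1)) * h (x (t - 1)) \<le> h (z (t - 1)) + \<tau> (t - 1) * h (x (t - 2))"
      using extrapolation_convex(1)[OF hconv \<tau>[OF t1(1)] zX[OF t1(1)] xX xs[OF t1(1)]] t1 by simp
    have "(1 + \<tau> (t - 1)) *\<^sub>R x (t - 1) = z (t - 1) + \<tau> (t - 1) *\<^sub>R x (t - 2)"
      using xs[OF t1(1)] \<tau>[OF t1(1)] t1 by simp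
    then have z: "z (t - 1) = x (t - 1) + \<tau> (t - 1) *\<^sub>R (x (t - 1) - x (t - 2))"
      by (simp add: algebra_simps)
    have fu: "f (x (t - 1)) + g (x (t - 1)) \<bullet> (u - x (t - 1)) \<le> f u"
      using sub by (auto simp: subdifferential_def)
    have "g (x (t - 1)) \<bullet> (z (t - 1) - u)
        = - (g (x (t - 1)) \<bullet> (u - x (t - 1)))
          + \<tau> (t - 1) * (D (t - 1) - f (x (t - 2)) + f (x (t - 1)))"
      unfolding z D_def t1(2) by (simp add: inner_simps algebra_simps)
    with hx fu have "(1 + \<tau> (t - 1)) * \<Psi> (x (t - 1)) - \<tau> (t - 1) * \<Psi> (x (t - 2)) - \<Psi> u
        + \<tau> (t - 1) * D (t - 1)
        \<le> g (x (t - 1)) \<bullet> (z (t - 1) - u) + h (z (t - 1)) - h u"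
      by (simp add: Psi algebra_simps)
    then have "\<eta> t * ((1 + \<tau> (t - 1)) * \<Psi> (x (t - 1)) - \<tau> (t - 1) * \<Psi> (x (t - 2)) - \<Psi> u
        + \<tau> (t - 1) * D (t - 1))
        \<le> \<eta> t * (g (x (t - 1)) \<bullet> (z (t - 1) - u) + h (z (t - 1)) - h u)"
      using \<eta>[of t] t by (intro mult_left_mono) auto
    then show ?thesis by (simp add: e_def distrib_left)
  qed

  \<comment> \<open>The denominator uses \<open>\<beta>s (t - 1)\<close>, not
    \<open>\<beta>\<close>: at \<open>t = 2\<close> it is 0, so that
    \<open>r 2 = \<eta> 2 / \<eta> 1\<close>, the ratio in the claimed bound.\<close>
  define r where "r = (\<lambda>t. \<eta> t / (\<eta> (t - 1) * (1 - \<beta>s (t - 1))))"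
  have \<beta>s1: "\<beta>s t < 1" if "t \<ge> 1" for t
    using \<beta>s \<beta> that by (cases "t = 1") auto
  have link: "z t - y t = (1 - \<beta>s t) *\<^sub>R (z t - y (t - 1))" if "t \<ge> 1" for t
    by (subst ys[OF that]) (simp add: algebra_simps)
  have pair: "\<eta> t * (g (x (t - 1)) \<bullet> (z (t - 1) - u) + h (z (t - 1)) - h u)
    \<le> 1 / (2 * \<beta>) * (norm (y (t - 1) - u))\<^sup>2 - 1 / (2 * \<beta>) * (norm (y t - u))\<^sup>2
      - (2 - \<beta> - r t) / 2 * (norm (z t - y (t - 1)))\<^sup>2 - r t / 2 * (norm (z (t - 1) - y (t - 1)))\<^sup>2
      - r t / 2 * (norm (z t - z (t - 1)))\<^sup>2
      - \<eta> t * ((g (x (t - 1)) - g (x (t - 2))) \<bullet> (z t - z (t - 1)))" if t: "t \<ge> 2" for t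
  proof (rule prox_pair_bound)
    have t1: "t \<ge> 1" "t - 1 \<ge> 1" "t - 1 - 1 = t - 2" using t by auto
    show "0 \<le> \<eta> t * (g (x (t - 1)) \<bullet> (u - z t) + h u - h (z t)) + (z t - y (t - 1)) \<bullet> (u - z t)"
      by (rule prox_optimality[OF hconv Xconv min[OF t1(1)] \<eta>[OF t1(1)] uX])
    show "0 \<le> \<eta> (t - 1) * (g (x (t - 2)) \<bullet> (z t - z (t - 1)) + h (z t) - h (z (t - 1)))
        + (z (t - 1) - y (t - 2)) \<bullet> (z t - z (t - 1))"
      using prox_optimality[OF hconv Xconv min[OF t1(2)] \<eta>[OF t1(2)] zX[OF t1(1)]] t1(3) by simp
    show "z (t - 1) - y (t - 1) = (1 - \<beta>s (t - 1)) *\<^sub>R (z (t - 1) - y (t - 2))"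
      using link[OF t1(2)] t1(3) by simp
    show "y t = (1 - \<beta>) *\<^sub>R y (t - 1) + \<beta> *\<^sub>R z t" using ys[OF t1(1)] \<beta>s t by simp
  qed (use t \<beta> \<beta>s1 \<eta> in \<open>auto simp: r_def\<close>)

  have cond: "\<eta> t \<le> 2 * (1 - \<beta>)\<^sup>2 * \<eta> (t - 1)"
    "ereal (\<eta> t) \<le> ereal (\<tau> (t - 1)) / (4 * Ltilde f g \<tau> x \<epsilon> (t - 1))"
    "ereal (\<eta> t) \<le> ereal (\<tau> (t - 2) + 1) / ereal (\<tau> (t - 1)) * ereal (\<eta> (t - 1))"
    if "t \<ge> 3" for t
    using assms(24)[OF that] by (auto simp only: min.bounded_iff ereal_less_eq)
  have \<tau>pos: "\<tau> (t - 1) > 0"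
    and smooth: "4 * \<eta> t * (norm (g (x (t - 1)) - g (x (t - 2))))\<^sup>2 \<le> 2 * \<tau> (t - 1) * D (t - 1) + \<epsilon>"
    if t: "t \<ge> 3" for t
  proof -
    have eq: "t - 1 - 1 = t - 2" by simp
    note c = le_divide_LtildeD[OF cond(2)[OF t] \<eta> \<tau> \<epsilon> sub]
    show "\<tau> (t - 1) > 0" using c(1) t by simp
    show "4 * \<eta> t * (norm (g (x (t - 1)) - g (x (t - 2))))\<^sup>2 \<le> 2 * \<tau> (t - 1) * D (t - 1) + \<epsilon>"
      using c(2) t unfolding D_def eq by simp
  qed
  \<comment> \<open>The third stepsize condition at index \<open>t + 2\<close>, where
    \<open>\<tau>pos\<close> permits clearing the denominator.\<close>
  have mono: "\<tau> (t + 1) * \<eta> (t + 2) \<le> (\<tau> t + 1) * \<eta> (t + 1)" if "t \<ge> 1" for t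
    using cond(3)[of "t + 2"] \<tau>pos[of "t + 2"] that by (simp add: field_simps)

  have descent: "e t \<le> V (t - 1) - V t + \<eta> t * (\<epsilon> / 2)" if t: "t \<ge> 3" for t
  proof -
    have t1: "t - 1 \<ge> 1" "t - 1 - 1 = t - 2" "\<beta>s (t - 1) = \<beta>" using t \<beta>s by auto
    have \<eta>t: "\<eta> t > 0" "\<eta> (t - 1) > 0" using \<eta> t by auto
    define A B C where "A = (norm (z t - y (t - 1)))\<^sup>2" and "B = (norm (z (t - 1) - y (t - 1)))\<^sup>2"
      and "C = (norm (z t - z (t - 1)))\<^sup>2"
    have rt: "r t = \<eta> t / (\<eta> (t - 1) * (1 - \<beta>))" unfolding r_def t1(3) ..
    have r: "0 \<le> r t" "r t \<le> 2 * (1 - \<beta>)"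
      using \<eta>t \<beta> cond(1)[OF t]
      by (auto simp: rt pos_divide_le_eq power2_eq_square mult.assoc mult.left_commute mult.commute)
    have coeff: "(1 - \<beta>)\<^sup>2 / 4 * A + C / 8 \<le> (2 - \<beta> - r t) / 2 * A + (r t / 2 + 1 / 4) * B + r t / 2 * C"
    proof (rule potential_coefficients[OF \<beta> r])
      show "A \<le> 2 * B + 2 * C"
        using norm_diff_sq_le[of "z t" "y (t - 1)" "z (t - 1)"] by (simp add: A_def B_def C_def)
      show "C \<le> 2 * A + 2 * B"
        using norm_diff_sq_le[of "z t" "z (t - 1)" "y (t - 1)"]
        by (simp add: A_def B_def C_def norm_minus_commute)
    qed (simp_all add: A_def B_def C_def)
    \<comment> \<open>Averaging contracts the distance to \<open>z (t - 1)\<close> by the factor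
      \<open>1 - \<beta>\<close>, so the second term of \<open>V (t - 1)\<close> is exactly
      \<open>B / 4\<close>.\<close>
    have B: "B = (1 - \<beta>)\<^sup>2 * (norm (z (t - 1) - y (t - 2)))\<^sup>2"
      unfolding B_def link[OF t1(1), unfolded t1(2,3)] by (simp add: power_mult_distrib)
    have V: "V (t - 1) = 1 / (2 * \<beta>) * (norm (y (t - 1) - u))\<^sup>2 + B / 4"
      "V t = 1 / (2 * \<beta>) * (norm (y t - u))\<^sup>2 + (1 - \<beta>)\<^sup>2 / 4 * A"
      unfolding V_def A_def B t1(2) by simp_all
    \<comment> \<open>Half of this bounds the gradient term of Young's inequality with weight 2: its
      \<open>D\<close> part is the gain in \<open>gap\<close>, and its other part is the source of
      \<open>\<epsilon> / 2\<close> in the rate.\<close>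
    have "\<eta> t * (4 * \<eta> t * (norm (g (x (t - 1)) - g (x (t - 2))))\<^sup>2)
        \<le> \<eta> t * (2 * \<tau> (t - 1) * D (t - 1) + \<epsilon>)"
      using smooth[OF t] \<eta>t by (intro mult_left_mono) auto
    then have s: "2 * (\<eta> t)\<^sup>2 * (norm (g (x (t - 1)) - g (x (t - 2))))\<^sup>2
        \<le> \<eta> t * (\<tau> (t - 1) * D (t - 1)) + \<eta> t * (\<epsilon> / 2)"
      by (simp add: power2_eq_square algebra_simps)
    have yg: "- (\<eta> t * ((g (x (t - 1)) - g (x (t - 2))) \<bullet> (z t - z (t - 1))))
        \<le> 2 * (\<eta> t)\<^sup>2 * (norm (g (x (t - 1)) - g (x (t - 2))))\<^sup>2 + C / 8"
      using inner_young[of 2 "\<eta> t"] by (simp add: C_def)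
    have "e t \<le> 1 / (2 * \<beta>) * (norm (y (t - 1) - u))\<^sup>2 - 1 / (2 * \<beta>) * (norm (y t - u))\<^sup>2
        - (2 - \<beta> - r t) / 2 * A - r t / 2 * B - r t / 2 * C + C / 8 + \<eta> t * (\<epsilon> / 2)"
      using gap[of t] pair[of t] s yg t unfolding A_def B_def C_def by linarith
    also have "\<dots> \<le> V (t - 1) - V t + \<eta> t * (\<epsilon> / 2)"
      using coeff unfolding V distrib_right by linarith
    finally show ?thesis .
  qed

  define l where "l = Ltilde1 g x \<epsilon>"
  define N where "N = (norm (z 1 - z 0))\<^sup>2"
  define R where "R = 1 / (2 * \<beta>) * (norm (z 0 - u))\<^sup>2 + (5 * \<eta> 2 * l / 4 - \<eta> 2 / (2 * \<eta> 1)) * N"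
  have base_bound: "e 2 \<le> R - V 2 + \<eta> 2 * (\<epsilon> / 2)"
  proof -
    have x1: "x 1 = z 1" using xs[of 1] \<tau>1 by simp
    have zx: "z 1 - z 0 = x 1 - x 0" unfolding x1 zero(3) ..
    have y1: "y 1 = z 0" using ys[of 1] \<beta>s zero by simp
    have \<eta>p: "\<eta> 2 > 0" "\<eta> 1 > 0" using \<eta> by auto
    define A where "A = (norm (z 2 - z 0))\<^sup>2"
    define d where "d = g (x 1) - g (x 0)"
    have l: "0 \<le> l" "(norm d)\<^sup>2 = l\<^sup>2 * N + l * \<epsilon> / 2" "d \<bullet> (z 1 - z 0) \<le> l * N + \<epsilon> / 4"
      unfolding l_def N_def d_def zx by (fact Ltilde1_properties[OF assms(17) \<epsilon>])+
    have \<eta>21: "\<eta> 2 \<le> (1 - \<beta>) * \<eta> 1" "ereal (\<eta> 2) \<le> 1 / (4 * ereal l)"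
      using \<eta>2 by (auto simp only: min.bounded_iff ereal_less_eq l_def)
    have N: "N \<ge> 0" by (simp add: N_def)
    have r: "r 2 = \<eta> 2 / \<eta> 1" "r 2 \<le> 1 - \<beta>" "r 2 \<ge> 0"
      using \<eta>21(1) \<eta>p \<beta>s(1) by (simp_all add: r_def pos_divide_le_eq)
    have \<eta>l: "\<eta> 2 * l \<le> 1 / 4"
    \<comment> \<open>If \<open>l = 0\<close>, the stepsize bound is infinite and says nothing, but
      the product vanishes.\<close>
    proof (cases "l = 0")
      case False
      then have "\<eta> 2 \<le> 1 / (4 * l)" using \<eta>21(2) by (simp add: one_ereal_def)
      then show ?thesis using False l by (simp add: field_simps)
    qed simp
    text \<open>Since \<open>\<tau> 1 = 0\<close> there is no smoothness gain \<open>D\<close> here: only the component of \<open>z 2 - z 1\<close>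
      along \<open>z 2 - z 0\<close> is absorbed quadratically, the rest is bounded through \<open>Ltilde1\<close>.\<close>
    have "(\<eta> 2 * l) * (\<eta> 2 * (l * N + \<epsilon> / 2)) \<le> 1 / 4 * (\<eta> 2 * (l * N + \<epsilon> / 2))"
      using \<eta>l \<eta>p l N \<epsilon> by (intro mult_right_mono) auto
    then have G: "(\<eta> 2)\<^sup>2 * (norm d)\<^sup>2 \<le> \<eta> 2 * (l * N) / 4 + \<eta> 2 * \<epsilon> / 8"
      unfolding l(2) by (simp add: power2_eq_square algebra_simps)
    have yg: "- (\<eta> 2 * (d \<bullet> (z 2 - z 0))) \<le> (\<eta> 2)\<^sup>2 * (norm d)\<^sup>2 + A / 4"
      using inner_young[of 1 "\<eta> 2"] by (simp add: A_def)
    have "\<eta> 2 * (d \<bullet> (z 1 - z 0)) \<le> \<eta> 2 * (l * N + \<epsilon> / 4)"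
      using l(3) \<eta>p by (intro mult_left_mono) auto
    moreover have "- (\<eta> 2 * (d \<bullet> (z 2 - z 1))) = - (\<eta> 2 * (d \<bullet> (z 2 - z 0))) + \<eta> 2 * (d \<bullet> (z 1 - z 0))"
      by (simp add: inner_simps algebra_simps)
    moreover have "\<eta> 2 * \<epsilon> \<ge> 0" using \<eta>p \<epsilon> by simp
    \<comment> \<open>The coefficient 5/4 is 1 from the inner product with \<open>z 1 - z 0\<close>
      plus 1/4 from \<open>G\<close>. The accuracy terms 1/4 and 1/8 stay below 1/2.\<close>
    ultimately have cross: "- (\<eta> 2 * (d \<bullet> (z 2 - z 1)))
        \<le> 5 * \<eta> 2 * l / 4 * N + A / 4 + \<eta> 2 * (\<epsilon> / 2)"
      using G yg by (simp add: algebra_simps)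
    have C: "0 \<le> r 2 / 2 * (norm (z 2 - z 1))\<^sup>2" using r(3) by simp
    \<comment> \<open>As \<open>r 2\<close> is at most \<open>1 - \<beta>\<close>, the available
      coefficient of \<open>A\<close> is at least 1/2, which covers both the Young cost 1/4 and the
      share stored in \<open>V 2\<close>.\<close>
    have "\<beta>\<^sup>2 \<le> \<beta>" using \<beta> by (simp add: power2_eq_square mult_le_one)
    then have "(1 - \<beta>)\<^sup>2 / 4 + 1 / 4 \<le> (2 - \<beta> - r 2) / 2"
      using r(2) \<beta> by (simp add: power2_diff field_simps)
    then have "((1 - \<beta>)\<^sup>2 / 4 + 1 / 4) * A \<le> (2 - \<beta> - r 2) / 2 * A"
      by (intro mult_right_mono) (simp_all add: A_def)
    then have A: "(1 - \<beta>)\<^sup>2 / 4 * A + A / 4 \<le> (2 - \<beta> - r 2) / 2 * A"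
      by (simp add: algebra_simps)
    have "e 2 \<le> 1 / (2 * \<beta>) * (norm (z 0 - u))\<^sup>2 - 1 / (2 * \<beta>) * (norm (y 2 - u))\<^sup>2
        - (2 - \<beta> - r 2) / 2 * A - r 2 / 2 * N
        - r 2 / 2 * (norm (z 2 - z 1))\<^sup>2 - \<eta> 2 * (d \<bullet> (z 2 - z 1))"
      using gap[of 2] pair[of 2] \<tau>1 y1 by (simp add: A_def N_def d_def)
    then have "e 2 \<le> 1 / (2 * \<beta>) * (norm (z 0 - u))\<^sup>2 - 1 / (2 * \<beta>) * (norm (y 2 - u))\<^sup>2
        - (1 - \<beta>)\<^sup>2 / 4 * A - r 2 / 2 * N + 5 * \<eta> 2 * l / 4 * N + \<eta> 2 * (\<epsilon> / 2)"
      using cross C A by linarith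
    moreover have "V 2 = 1 / (2 * \<beta>) * (norm (y 2 - u))\<^sup>2 + (1 - \<beta>)\<^sup>2 / 4 * A"
      using y1 by (simp add: V_def A_def)
    moreover have "R = 1 / (2 * \<beta>) * (norm (z 0 - u))\<^sup>2 + 5 * \<eta> 2 * l / 4 * N - r 2 / 2 * N"
      by (simp add: R_def r(1) left_diff_distrib)
    ultimately show ?thesis by linarith
  qed

  define S where "S = (\<Sum>t=2..k+1. \<eta> t)"
  have "(\<Sum>t=2..k+1. e t) \<le> R - V (k + 1) + (\<Sum>t=2..k+1. \<eta> t) * (\<epsilon> / 2)"
    using k
  proof (induction k rule: dec_induct)
    case base
    then show ?case using base_bound by (simp add: numeral_2_eq_2)
  next
    case (step k)
    then show ?case using descent[of "k + 2"] by (simp add: algebra_simps)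
  qed
  moreover have "V (k + 1) \<ge> 0" using \<beta> by (simp add: V_def)
  moreover have "S * (\<Psi> (xbar \<eta> \<tau> x k) - \<Psi> u) \<le> (\<Sum>t=2..k+1. e t)"
    unfolding S_def e_def by (rule xbar_convex_le[OF \<Psi>conv xX k \<tau>1 \<tau> \<eta> mono])
  ultimately have le: "S * (\<Psi> (xbar \<eta> \<tau> x k) - \<Psi> u) \<le> R + S * (\<epsilon> / 2)"
    by (simp add: S_def)
  have S: "S > 0" unfolding S_def using k \<eta> by (intro sum_pos) auto
  have "\<Psi> (xbar \<eta> \<tau> x k) - \<Psi> u \<le> 1 / S * R + \<epsilon> / 2"
    using le S by (simp add: field_simps)
  then show "\<Psi> (xbar \<eta> \<tau> x k) - \<Psi> u
      \<le> 1 / (\<Sum>t=2..k+1. \<eta> t) *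
          (1 / (2 * \<beta>) * (norm (z 0 - u))\<^sup>2
            + (5 * \<eta> 2 * Ltilde1 g x \<epsilon> / 4 - \<eta> 2 / (2 * \<eta> 1)) * (norm (z 1 - z 0))\<^sup>2)
        + \<epsilon> / 2"
    by (simp only: S_def R_def l_def N_def)
qed

end
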